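(* Let $X$ and $Y$ be sets, let $c\colon X\to\mathcal{D}(Y)$ be a channel, let $\sigma\in\mathcal{D}(X)$ be a distribution, and let $q\colon Y\to[0,1]$ be a predicate on $Y$. Assume $\sigma\models c^{*}q\neq 0$, so that $\sigma_P=\sigma|_{c^{*}q}$ is defined. Then \[ (c_{*}\sigma_P)\models q \;\geq\; (c_{*}\sigma)\models q. \]
   Context: For a set $Z$, $\mathcal{D}(Z)$ denotes the set of finitely supported probability distributions on $Z$, i.e. functions $\omega\colon Z\to[0,1]$ with finite support and $\sum_z\omega(z)=1$. A predicate on $Z$ is a function $p\colon Z\to[0,1]$. A channel $c\colon X\to\mathcal{D}(Y)$ assigns a distribution $c(x)\in\mathcal{D}(Y)$ to each $x\in X$. Validity: $\omega\models p=\sum_{z}\omega(z)\,p(z)$. If $\omega\models p\neq0$, the update of $\omega$ with $p$ is the distribution $\omega|_p(z)=\omega(z)p(z)/(\omega\models p)$. State transformation: $(c_{*}\sigma)(y)=\sum_{x}\sigma(x)\,c(x)(y)$, a distribution on $Y$. Predicate transformation: for a predicate $q$ on $Y$, $(c^{*}q)(x)=\sum_{y}c(x)(y)\,q(y)$, a predicate on $X$. *)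

theory Defs
  imports "HOL-Probability.Probability_Mass_Function"
begin

definition fin_dists :: "'z pmf set" where
  "fin_dists = {\<omega>. finite (set_pmf \<omega>)}"

definition predicate :: "('z \<Rightarrow> real) \<Rightarrow> bool" where
  "predicate p \<longleftrightarrow> (\<forall>z. 0 \<le> p z \<and> p z \<le> 1)"

definition channel :: "('x \<Rightarrow> 'y pmf) \<Rightarrow> bool" where
  "channel c \<longleftrightarrow> (\<forall>x. c x \<in> fin_dists)"

(* Only meaningful for finitely supported distributions: on an infinite support
   the sum would be 0 by convention. The same applies to pred_trans. *)
definition validity :: "'z pmf \<Rightarrow> ('z \<Rightarrow> real) \<Rightarrow> real" where
  "validity \<omega> p = (\<Sum>z\<in>set_pmf \<omega>. pmf \<omega> z * p z)"

(* embed_pmf is only specified for nonnegative functions of total mass 1;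
   pmf_update shows that this is the case for a finitely supported distribution
   and a predicate whose validity is nonzero. *)
definition update :: "'z pmf \<Rightarrow> ('z \<Rightarrow> real) \<Rightarrow> 'z pmf" where
  "update \<omega> p = embed_pmf (\<lambda>z. pmf \<omega> z * p z / validity \<omega> p)"

definition state_trans :: "('x \<Rightarrow> 'y pmf) \<Rightarrow> 'x pmf \<Rightarrow> 'y pmf" where
  "state_trans c \<sigma> = bind_pmf \<sigma> c"

definition pred_trans :: "('x \<Rightarrow> 'y pmf) \<Rightarrow> ('y \<Rightarrow> real) \<Rightarrow> 'x \<Rightarrow> real" where
  "pred_trans c q x = (\<Sum>y\<in>set_pmf (c x). pmf (c x) y * q y)"

lemma validity_nonneg: "predicate p \<Longrightarrow> 0 \<le> validity \<omega> p"
  by (auto simp: validity_def predicate_def intro!: sum_nonneg)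

lemma pmf_update:
  assumes "\<omega> \<in> fin_dists" "predicate p" "validity \<omega> p \<noteq> 0"
  shows "pmf (update \<omega> p) z = pmf \<omega> z * p z / validity \<omega> p"
  unfolding update_def
proof (rule pmf_embed_pmf)
  let ?f = "\<lambda>z. pmf \<omega> z * p z / validity \<omega> p"
  have fin: "finite (set_pmf \<omega>)"
    using assms(1) by (simp add: fin_dists_def)
  show nonneg: "0 \<le> ?f z" for z
    using assms(2) validity_nonneg[OF assms(2)] by (simp add: predicate_def)
  have "(\<integral>\<^sup>+z. ennreal (?f z) \<partial>count_space UNIV)
      = (\<Sum>z\<in>set_pmf \<omega>. ennreal (?f z))"
    by (rule nn_integral_count_space'[OF fin]) (auto simp: set_pmf_iff)
  also have "\<dots> = ennreal (\<Sum>z\<in>set_pmf \<omega>. ?f z)"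
    by (rule sum_ennreal) (rule nonneg)
  also have "(\<Sum>z\<in>set_pmf \<omega>. ?f z) = 1"
    using assms(3) by (simp add: validity_def flip: sum_divide_distrib)
  finally show "(\<integral>\<^sup>+z. ennreal (?f z) \<partial>count_space UNIV) = 1"
    by simp
qed

lemma update_in_fin_dists:
  assumes "\<omega> \<in> fin_dists" "predicate p" "validity \<omega> p \<noteq> 0"
  shows "update \<omega> p \<in> fin_dists"
proof -
  have "set_pmf (update \<omega> p) \<subseteq> set_pmf \<omega>"
    by (auto simp: set_pmf_iff pmf_update[OF assms])
  then show ?thesis
    using assms(1) by (auto simp: fin_dists_def intro: finite_subset)
qed

lemma pmf_state_trans:
  assumes "\<sigma> \<in> fin_dists"
  shows "pmf (state_trans c \<sigma>) y = (\<Sum>x\<in>set_pmf \<sigma>. pmf \<sigma> x * pmf (c x) y)"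
  using assms unfolding state_trans_def fin_dists_def pmf_bind
  by (subst integral_measure_pmf[of "set_pmf \<sigma>"]) (auto simp: mult.commute)

lemma state_trans_in_fin_dists:
  "channel c \<Longrightarrow> \<sigma> \<in> fin_dists \<Longrightarrow> state_trans c \<sigma> \<in> fin_dists"
  by (simp add: channel_def fin_dists_def state_trans_def)

lemma predicate_pred_trans:
  assumes "channel c" "predicate q"
  shows "predicate (pred_trans c q)"
  unfolding predicate_def
proof (intro allI conjI)
  fix x
  have "finite (set_pmf (c x))"
    using assms(1) by (simp add: channel_def fin_dists_def)
  then have "(\<Sum>y\<in>set_pmf (c x). pmf (c x) y) = 1"
    by (simp add: sum_pmf_eq_1)
  moreover have "pred_trans c q x \<le> (\<Sum>y\<in>set_pmf (c x). pmf (c x) y)"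
    unfolding pred_trans_def using assms(2)
    by (intro sum_mono) (simp add: predicate_def mult_left_le)
  ultimately show "pred_trans c q x \<le> 1"
    by simp
  show "0 \<le> pred_trans c q x"
    using assms(2) by (auto simp: pred_trans_def predicate_def intro!: sum_nonneg)
qed

end

theory Submission
  imports Defs
begin

text \<open>
  Write \<open>p = c\<^sup>* q\<close>. Validity of \<open>q\<close> after state transformation is validity of \<open>p\<close> before it, and
  the validity of \<open>p\<close> in \<open>\<sigma>\<close> updated with \<open>p\<close> is \<open>E[p\<^sup>2] / E[p]\<close> with expectations taken in \<open>\<sigma>\<close>.
  The claim \<open>E[p\<^sup>2] / E[p] \<ge> E[p]\<close> is thus nonnegativity of the variance of \<open>p\<close>.
\<close>

text \<open>Points outside the support have weight 0. This allows distributions with different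
  supports to be summed over one common finite set.\<close>

lemma validity_eq_sum:
  assumes "finite A" "set_pmf \<omega> \<subseteq> A"
  shows "validity \<omega> p = (\<Sum>z\<in>A. pmf \<omega> z * p z)"
  unfolding validity_def
  by (rule sum.mono_neutral_left) (use assms in \<open>auto simp: set_pmf_iff\<close>)

lemma validity_state_trans:
  assumes "channel c" "\<sigma> \<in> fin_dists"
  shows "validity (state_trans c \<sigma>) q = validity \<sigma> (pred_trans c q)"
proof -
  let ?B = "set_pmf (state_trans c \<sigma>)"
  have fin: "finite ?B"
    using state_trans_in_fin_dists[OF assms] by (simp add: fin_dists_def)
  \<comment> \<open>The support of \<open>c x\<close> varies with \<open>x\<close>, which blocks
    exchanging the sums. Since the support of a bind is the union of these supports,
    \<open>?B\<close> serves for all relevant \<open>x\<close>.\<close>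
  have pt: "pred_trans c q x = (\<Sum>y\<in>?B. pmf (c x) y * q y)" if "x \<in> set_pmf \<sigma>" for x
    using validity_eq_sum[OF fin, of "c x" q] that
    by (auto simp: validity_def pred_trans_def state_trans_def)
  have "validity (state_trans c \<sigma>) q
      = (\<Sum>y\<in>?B. \<Sum>x\<in>set_pmf \<sigma>. pmf \<sigma> x * (pmf (c x) y * q y))"
    by (simp add: validity_def pmf_state_trans[OF assms(2)] sum_distrib_right mult.assoc)
  also have "\<dots> = (\<Sum>x\<in>set_pmf \<sigma>. \<Sum>y\<in>?B. pmf \<sigma> x * (pmf (c x) y * q y))"
    by (rule sum.swap)
  also have "\<dots> = validity \<sigma> (pred_trans c q)"
    by (simp add: validity_def pt sum_distrib_left)
  finally show ?thesis .
qed

lemma validity_update: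
  assumes "\<omega> \<in> fin_dists" "predicate p" "validity \<omega> p \<noteq> 0"
  shows "validity (update \<omega> p) r = validity \<omega> (\<lambda>z. p z * r z) / validity \<omega> p"
proof -
  \<comment> \<open>The inclusion can be strict: points where \<open>p\<close> vanishes drop out of
    the support.\<close>
  have "set_pmf (update \<omega> p) \<subseteq> set_pmf \<omega>"
    by (auto simp: set_pmf_iff pmf_update[OF assms])
  moreover have "finite (set_pmf \<omega>)"
    using assms(1) by (simp add: fin_dists_def)
  ultimately have "validity (update \<omega> p) r = (\<Sum>z\<in>set_pmf \<omega>. pmf (update \<omega> p) z * r z)"
    by (intro validity_eq_sum)
  also have "\<dots> = (\<Sum>z\<in>set_pmf \<omega>. pmf \<omega> z * (p z * r z)) / validity \<omega> p"
    by (simp add: pmf_update[OF assms] sum_divide_distrib mult.assoc)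
  finally show ?thesis
    by (simp add: validity_def[of \<omega> "\<lambda>z. p z * r z"])
qed

lemma validity_power2_le:
  assumes "\<omega> \<in> fin_dists"
  shows "(validity \<omega> p)\<^sup>2 \<le> validity \<omega> (\<lambda>z. (p z)\<^sup>2)"
proof -
  let ?v = "validity \<omega> p"
  have one: "(\<Sum>z\<in>set_pmf \<omega>. pmf \<omega> z) = 1"
    using assms by (simp add: fin_dists_def sum_pmf_eq_1)
  \<comment> \<open>This is the variance of \<open>p\<close>, as \<open>?v\<close> is its mean.
    After expansion, \<open>one\<close> reduces the constant term to
    \<open>?v\<^sup>2\<close>.\<close>
  have "0 \<le> (\<Sum>z\<in>set_pmf \<omega>. pmf \<omega> z * (p z - ?v)\<^sup>2)"
    by (intro sum_nonneg) simp
  also have "\<dots> = (\<Sum>z\<in>set_pmf \<omega>. pmf \<omega> z * (p z)\<^sup>2 - 2 * ?v * (pmf \<omega> z * p z) + ?v\<^sup>2 * pmf \<omega> z)"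
    by (simp add: power2_eq_square algebra_simps)
  also have "\<dots> = validity \<omega> (\<lambda>z. (p z)\<^sup>2) - 2 * ?v * ?v + ?v\<^sup>2"
    by (simp add: sum.distrib sum_subtractf one validity_def flip: sum_distrib_left)
  finally show ?thesis
    by (simp add: power2_eq_square)
qed

theorem theorem3p2:
  fixes c :: "'x \<Rightarrow> 'y pmf" and \<sigma> :: "'x pmf" and q :: "'y \<Rightarrow> real"
  assumes "channel c"
    and "\<sigma> \<in> fin_dists"
    and "predicate q"
    and "validity \<sigma> (pred_trans c q) \<noteq> 0"
  shows "validity (state_trans c (update \<sigma> (pred_trans c q))) q
       \<ge> validity (state_trans c \<sigma>) q"
proof -
  let ?p = "pred_trans c q"
  have pred: "predicate ?p"
    using assms by (intro predicate_pred_trans)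
  \<comment> \<open>Strict positivity lets the denominator be cleared without reversing the
    inequality.\<close>
  have "validity \<sigma> ?p > 0"
    using validity_nonneg[OF pred, of \<sigma>] assms(4) by linarith
  then have "validity \<sigma> ?p \<le> validity \<sigma> (\<lambda>x. ?p x * ?p x) / validity \<sigma> ?p"
    using validity_power2_le[OF assms(2), of ?p] by (simp add: power2_eq_square pos_le_divide_eq)
  also have "\<dots> = validity (update \<sigma> ?p) ?p"
    by (rule validity_update[OF assms(2) pred assms(4), symmetric])
  \<comment> \<open>Both sides are pulled back along \<open>c\<close>; for the updated state this
    requires its support to be finite.\<close>
  finally show ?thesis
    by (simp add: validity_state_trans assms update_in_fin_dists pred)
qed

end
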